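(* Let $(X,\mathcal{F},\mu)$ be a probability measure space and let $T_1,T_2$ be two measure preserving transformations on this space. Let $\mathcal{I}_1$ and $\mathcal{I}_2$ denote the $\sigma$-algebras of invariant sets for $T_1$ and $T_2$ respectively. Let $A\in\mathcal{F}$ be a set of positive measure. Then the following limit exists and $$\lim_{N\to\infty}\frac{1}{N^2}\sum_{n,m=1}^N\mu\bigl(A\cap T_1^{-n}A\cap T_2^{-n-m}A\bigr)=\int_A\mathbb{E}(\mathbf{1}_A,\mathcal{I}_1)(x)\,\mathbb{E}(\mathbf{1}_A,\mathcal{I}_2)(x)\,d\mu(x).$$ In particular, if $\mathcal{I}_1\subset\mathcal{I}_2$ or $\mathcal{I}_2\subset\mathcal{I}_1$, then $$\lim_{N\to\infty}\frac{1}{N^2}\sum_{n,m=1}^N\mu\bigl(A\cap T_1^{-n}A\cap T_2^{-n-m}A\bigr)\ge\mu(A)^3 .$$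
   Context: $T_1$ and $T_2$ are not assumed to commute. $\mathbf{1}_A$ is the indicator function of $A$, and $\mathbb{E}(f,\mathcal{I})$ denotes the conditional expectation of $f$ with respect to the sub-$\sigma$-algebra $\mathcal{I}$ (and the measure $\mu$). *)

theory Defs
  imports "HOL-Probability.Probability"
begin

definition measure_preserving :: "'a measure \<Rightarrow> ('a \<Rightarrow> 'a) \<Rightarrow> bool" where
  "measure_preserving M T \<longleftrightarrow>
     T \<in> measurable M M \<and> (\<forall>B\<in>sets M. emeasure M (T -` B \<inter> space M) = emeasure M B)"

definition preimage_iter :: "'a measure \<Rightarrow> ('a \<Rightarrow> 'a) \<Rightarrow> nat \<Rightarrow> 'a set \<Rightarrow> 'a set" where
  "preimage_iter M T n B = (T ^^ n) -` B \<inter> space M"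

text \<open>Invariance is understood modulo null sets, so that inclusions between two invariant
  \<open>\<sigma>\<close>-algebras do not depend on the behaviour of the transformations on null sets. (With the strict
  requirement \<open>T -` B \<inter> space M = B\<close>, even the invariant \<open>\<sigma>\<close>-algebra of an ergodic
  transformation would in general not be contained in that of another transformation.)\<close>

definition invariant_sets :: "'a measure \<Rightarrow> ('a \<Rightarrow> 'a) \<Rightarrow> 'a set set" where
  "invariant_sets M T = {B \<in> sets M. emeasure M (sym_diff (T -` B \<inter> space M) B) = 0}"

definition invariant_algebra :: "'a measure \<Rightarrow> ('a \<Rightarrow> 'a) \<Rightarrow> 'a measure" where
  "invariant_algebra M T = sigma (space M) (invariant_sets M T)"

lemma invariant_sets_iff_AE:
  assumes [measurable]: "T \<in> measurable M M"
  shows "B \<in> invariant_sets M T \<longleftrightarrow> B \<in> sets M \<and> (AE x in M. T x \<in> B \<longleftrightarrow> x \<in> B)"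
proof (cases "B \<in> sets M")
  case True
  then have [measurable]: "B \<in> sets M" .
  have "sym_diff (T -` B \<inter> space M) B \<in> sets M"
    by measurable
  moreover have "sym_diff (T -` B \<inter> space M) B = {x \<in> space M. \<not> (T x \<in> B \<longleftrightarrow> x \<in> B)}"
    using sets.sets_into_space[OF True] by auto
  ultimately show ?thesis
    using True AE_iff_measurable[of "sym_diff (T -` B \<inter> space M) B" M "\<lambda>x. T x \<in> B \<longleftrightarrow> x \<in> B"]
    unfolding invariant_sets_def by fastforce
qed (simp add: invariant_sets_def)

lemma sigma_algebra_invariant_sets:
  assumes T: "T \<in> measurable M M"
  shows "sigma_algebra (space M) (invariant_sets M T)"
  unfolding sigma_algebra_iff2
proof (intro conjI ballI allI impI)
  show "invariant_sets M T \<subseteq> Pow (space M)"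
    using sets.space_closed by (auto simp: invariant_sets_def)
  show "{} \<in> invariant_sets M T"
    by (simp add: invariant_sets_iff_AE[OF T])
next
  fix B assume "B \<in> invariant_sets M T"
  then have "B \<in> sets M" "AE x in M. T x \<in> B \<longleftrightarrow> x \<in> B"
    by (auto simp: invariant_sets_iff_AE[OF T])
  moreover from this(2) have "AE x in M. T x \<in> space M - B \<longleftrightarrow> x \<in> space M - B"
    using AE_space by eventually_elim (use measurable_space[OF T] in auto)
  ultimately show "space M - B \<in> invariant_sets M T"
    by (auto simp: invariant_sets_iff_AE[OF T])
next
  fix B :: "nat \<Rightarrow> _" assume B: "range B \<subseteq> invariant_sets M T"
  then have "AE x in M. T x \<in> B i \<longleftrightarrow> x \<in> B i" for i
    using invariant_sets_iff_AE[OF T, of "B i"] by blast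
  then have "AE x in M. \<forall>i. T x \<in> B i \<longleftrightarrow> x \<in> B i"
    by (simp add: AE_all_countable)
  then have "AE x in M. T x \<in> (\<Union>i. B i) \<longleftrightarrow> x \<in> (\<Union>i. B i)"
    by eventually_elim auto
  moreover have "(\<Union>i. B i) \<in> sets M"
    using B by (auto simp: invariant_sets_def)
  ultimately show "(\<Union>i. B i) \<in> invariant_sets M T"
    by (simp add: invariant_sets_iff_AE[OF T])
qed

lemma sets_invariant_algebra:
  assumes "T \<in> measurable M M"
  shows "sets (invariant_algebra M T) = invariant_sets M T"
  unfolding invariant_algebra_def
  using sigma_algebra.sets_measure_of_eq[OF sigma_algebra_invariant_sets[OF assms]] by simp

lemma subalgebra_invariant_algebra:
  assumes "T \<in> measurable M M"
  shows "subalgebra M (invariant_algebra M T)"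
proof -
  have "space (invariant_algebra M T) = space M"
    by (simp add: invariant_algebra_def space_measure_of_conv)
  then show ?thesis
    using sets_invariant_algebra[OF assms] by (auto simp: subalgebra_def invariant_sets_def)
qed

end

theory Submission
  imports Defs
begin

text \<open>Average over \<open>m\<close> first. Since \<open>T\<^sub>2\<close> preserves \<open>\<mu>\<close> and fixes \<open>E(1\<^sub>A, I\<^sub>2)\<close>, the
  \<open>L\<^sup>1\<close> distance between \<open>1/N \<Sum>\<^sub>m 1\<^sub>A \<circ> T\<^sub>2\<^sup>n\<^sup>+\<^sup>m\<close> and \<open>E(1\<^sub>A, I\<^sub>2)\<close> does not depend on \<open>n\<close>, and it
  tends to 0 by Birkhoff's theorem and dominated convergence. What remains is a single ergodic average
  for \<open>T\<^sub>1\<close>, so that commutativity plays no role. For nested \<open>\<sigma>\<close>-algebras, put \<open>g = E(1\<^sub>A, I\<^sub>1)\<close> and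
  \<open>h = E(1\<^sub>A, I\<^sub>2)\<close> with \<open>I\<^sub>1 \<subseteq> I\<^sub>2\<close>: the limit is \<open>\<integral> g h\<^sup>2\<close>, which is at least
  \<open>\<integral> g\<^sup>3 \<ge> \<mu>(A)\<^sup>3\<close> by convexity.\<close>

section \<open>Birkhoff sums and their running maxima\<close>

definition birkhoff_sum :: "('a \<Rightarrow> 'a) \<Rightarrow> ('a \<Rightarrow> real) \<Rightarrow> nat \<Rightarrow> 'a \<Rightarrow> real" where
  "birkhoff_sum T f n x = (\<Sum>k<n. f ((T ^^ k) x))"

lemma birkhoff_sum_0 [simp]: "birkhoff_sum T f 0 x = 0"
  by (simp add: birkhoff_sum_def)

lemma birkhoff_sum_Suc: "birkhoff_sum T f (Suc n) x = f x + birkhoff_sum T f n (T x)"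
  unfolding birkhoff_sum_def by (subst sum.lessThan_Suc_shift) (simp add: funpow_swap1)

text \<open>This is the maximum of \<open>birkhoff_sum T f k x\<close> over
  \<open>k \<le> n\<close>, with the empty sum included. The recursive form is the one in which
  Garsia's identity can be read off directly.\<close>

primrec birkhoff_max :: "('a \<Rightarrow> 'a) \<Rightarrow> ('a \<Rightarrow> real) \<Rightarrow> nat \<Rightarrow> 'a \<Rightarrow> real" where
  "birkhoff_max T f 0 x = 0"
| "birkhoff_max T f (Suc n) x = max 0 (f x + birkhoff_max T f n (T x))"

lemma birkhoff_max_nonneg: "0 \<le> birkhoff_max T f n x"
  by (cases n) auto

lemma birkhoff_max_le_Suc: "birkhoff_max T f n x \<le> birkhoff_max T f (Suc n) x"
proof (induction n arbitrary: x)
  case (Suc n)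
  from Suc[of "T x"] show ?case
    by (simp only: birkhoff_max.simps(2))
qed simp

lemma birkhoff_max_mono: "m \<le> n \<Longrightarrow> birkhoff_max T f m x \<le> birkhoff_max T f n x"
  by (rule lift_Suc_mono_le[of "\<lambda>n. birkhoff_max T f n x"]) (rule birkhoff_max_le_Suc)

lemma birkhoff_sum_le_max: "birkhoff_sum T f n x \<le> birkhoff_max T f n x"
proof (induction n arbitrary: x)
  case (Suc n)
  from Suc[of "T x"] show ?case by (simp add: birkhoff_sum_Suc)
qed simp

text \<open>The two sequences differ by an index shift and the constant \<open>f x\<close>. Hence
  the set where the sums are unbounded above is invariant pointwise, not merely up to a null
  set.\<close>

lemma bdd_above_birkhoff_sum_shift:
  "bdd_above (range (\<lambda>n. birkhoff_sum T f n (T x))) \<longleftrightarrow> bdd_above (range (\<lambda>n. birkhoff_sum T f n x))"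
proof
  assume "bdd_above (range (\<lambda>n. birkhoff_sum T f n (T x)))"
  then obtain K where K: "\<And>n. birkhoff_sum T f n (T x) \<le> K"
    by (auto simp: bdd_above_def)
  \<comment> \<open>The 0 in the bound covers the empty sum, which has no predecessor at
    \<open>T x\<close>.\<close>
  have "birkhoff_sum T f n x \<le> max 0 (f x + K)" for n
    using K[of "n - 1"] by (cases n) (auto simp: birkhoff_sum_Suc)
  then show "bdd_above (range (\<lambda>n. birkhoff_sum T f n x))"
    by (auto simp: bdd_above_def)
next
  assume "bdd_above (range (\<lambda>n. birkhoff_sum T f n x))"
  then obtain K where K: "\<And>n. birkhoff_sum T f n x \<le> K"
    by (auto simp: bdd_above_def)
  have "birkhoff_sum T f n (T x) \<le> K - f x" for n
    using K[of "Suc n"] by (auto simp: birkhoff_sum_Suc)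
  then show "bdd_above (range (\<lambda>n. birkhoff_sum T f n (T x)))"
    by (auto simp: bdd_above_def)
qed

section \<open>Measure preserving systems\<close>

locale measure_preserving_system = prob_space M for M :: "'a measure" +
  fixes T :: "'a \<Rightarrow> 'a"
  assumes mpt: "measure_preserving M T"
begin

lemma T_measurable [measurable]: "T \<in> measurable M M"
  using mpt by (simp add: measure_preserving_def)

lemma funpow_measurable [measurable]: "(T ^^ n) \<in> measurable M M"
  by (rule measurable_compose_n) (rule T_measurable)

lemma distr_T: "distr M M T = M"
  using mpt by (intro measure_eqI) (auto simp: measure_preserving_def emeasure_distr)

lemma distr_funpow: "distr M M (T ^^ n) = M"
proof (induction n)
  case 0
  show ?case by (simp add: id_def distr_id2)
next
  case (Suc n)
  have "distr M M (T ^^ Suc n) = distr (distr M M (T ^^ n)) M T"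
    by (simp add: distr_distr)
  also have "\<dots> = M" by (simp only: Suc distr_T)
  finally show ?case .
qed

lemma integral_funpow:
  fixes f :: "'a \<Rightarrow> real"
  assumes "f \<in> borel_measurable M"
  shows "(\<integral>x. f ((T ^^ n) x) \<partial>M) = (\<integral>x. f x \<partial>M)"
  using integral_distr[of "T ^^ n" M M f] assms by (simp add: distr_funpow)

lemma integral_T:
  fixes f :: "'a \<Rightarrow> real"
  assumes "f \<in> borel_measurable M"
  shows "(\<integral>x. f (T x) \<partial>M) = (\<integral>x. f x \<partial>M)"
  using integral_funpow[OF assms, of 1] by simp

lemma integrable_T:
  fixes f :: "'a \<Rightarrow> real"
  assumes "integrable M f"
  shows "integrable M (\<lambda>x. f (T x))"
  using integrable_distr[of T M M f] assms by (simp add: distr_T)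

lemma AE_funpow:
  assumes "AE x in M. P x"
  shows "AE x in M. P ((T ^^ n) x)"
  by (rule AE_distrD[OF funpow_measurable]) (simp only: distr_funpow assms)

lemma birkhoff_sum_measurable [measurable]:
  "f \<in> borel_measurable M \<Longrightarrow> birkhoff_sum T f n \<in> borel_measurable M"
  unfolding birkhoff_sum_def[abs_def]
  by (intro borel_measurable_sum measurable_compose[OF funpow_measurable])

lemma integrable_birkhoff_max:
  "integrable M f \<Longrightarrow> integrable M (birkhoff_max T f n)"
proof (induction n)
  case 0
  have "birkhoff_max T f 0 = (\<lambda>_. 0)" by auto
  then show ?case by simp
next
  case (Suc n)
  then show ?case using integrable_T[of "birkhoff_max T f n"]
    by (auto intro!: Bochner_Integration.integrable_add integrable_max simp: fun_eq_iff)
qed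

section \<open>Invariant functions and the pointwise ergodic theorem\<close>

abbreviation "Inv \<equiv> invariant_algebra M T"

sublocale Inv: finite_measure_subalgebra M "invariant_algebra M T"
  by unfold_locales (rule subalgebra_invariant_algebra[OF T_measurable])

text \<open>Garsia's argument: on the invariant set where the sums are unbounded, the nonnegative integrals
  of \<open>birkhoff_max T f (Suc n) - birkhoff_max T f n \<circ> T = max (- birkhoff_max T f n \<circ> T) f\<close>
  converge to that of \<open>f\<close>.\<close>

lemma AE_bdd_above_birkhoff_sum:
  assumes f: "integrable M f"
    and neg: "\<And>B. B \<in> sets Inv \<Longrightarrow> measure M B > 0 \<Longrightarrow> (LINT x:B|M. f x) < 0"
  shows "AE x in M. bdd_above (range (\<lambda>n. birkhoff_sum T f n x))"
proof -
  have [measurable]: "f \<in> borel_measurable M" using f by auto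
  define B where "B = {x \<in> space M. \<not> bdd_above (range (\<lambda>n. birkhoff_sum T f n x))}"
  \<comment> \<open>Restricting the bounds to natural numbers makes the condition countable, so
    \<open>B\<close> is measurable.\<close>
  have bdd_iff: "bdd_above (range (\<lambda>n. birkhoff_sum T f n x)) \<longleftrightarrow>
      (\<exists>K::nat. \<forall>n. birkhoff_sum T f n x \<le> real K)" for x
  proof
    assume "bdd_above (range (\<lambda>n. birkhoff_sum T f n x))"
    then obtain K where "\<And>n. birkhoff_sum T f n x \<le> K"
      by (auto simp: bdd_above_def)
    moreover obtain L :: nat where "K \<le> real L" using real_arch_simple by blast
    ultimately show "\<exists>K::nat. \<forall>n. birkhoff_sum T f n x \<le> real K"
      by (meson order_trans)
  qed (auto simp: bdd_above_def)
  have B_meas [measurable]: "B \<in> sets M"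
    unfolding B_def bdd_iff by measurable
  have T_B: "T x \<in> B \<longleftrightarrow> x \<in> B" if "x \<in> space M" for x
    using that measurable_space[OF T_measurable that]
    by (auto simp: B_def bdd_above_birkhoff_sum_shift)
  have B_inv: "B \<in> sets Inv"
    unfolding sets_invariant_algebra[OF T_measurable] invariant_sets_iff_AE[OF T_measurable]
    using B_meas T_B by auto
  define D where "D n x = indicator B x * (birkhoff_max T f (Suc n) x - birkhoff_max T f n (T x))" for n x
  have max_int [simp]: "integrable M (birkhoff_max T f n)" for n
    by (rule integrable_birkhoff_max[OF f])
  have [measurable]: "birkhoff_max T f n \<in> borel_measurable M" for n
    using max_int[of n] by (rule borel_measurable_integrable)
  \<comment> \<open>With \<open>m\<close> the maximum at \<open>T x\<close>,
    \<open>max 0 (f x + m) - m = max (- m) (f x)\<close>. As \<open>m \<ge> 0\<close>, this also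
    gives the bound by \<open>\<bar>f x\<bar>\<close> used below.\<close>
  have D_eq: "D n x = indicator B x * max (- birkhoff_max T f n (T x)) (f x)" for n x
    by (auto simp: D_def max_def)
  have int_B: "integrable M (\<lambda>x. indicator B x * g x)" if "integrable M g" for g :: "'a \<Rightarrow> real"
    using integrable_mult_indicator[OF B_meas that] by simp
  \<comment> \<open>Invariance of \<open>B\<close> turns its indicator at \<open>x\<close> into that
    at \<open>T x\<close>, so measure preservation removes \<open>T\<close> from the subtracted
    integral; the maxima increase with \<open>n\<close>.\<close>
  have D_nonneg: "0 \<le> (\<integral>x. D n x \<partial>M)" for n
  proof -
    have "(\<integral>x. D n x \<partial>M) = (\<integral>x. indicator B x * birkhoff_max T f (Suc n) x \<partial>M)
        - (\<integral>x. indicator B x * birkhoff_max T f n (T x) \<partial>M)"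
      unfolding D_def right_diff_distrib
      by (intro Bochner_Integration.integral_diff int_B integrable_T max_int)
    moreover have "(\<integral>x. indicator B x * birkhoff_max T f n (T x) \<partial>M)
        = (\<integral>x. indicator B (T x) * birkhoff_max T f n (T x) \<partial>M)"
      by (intro Bochner_Integration.integral_cong) (auto simp: indicator_def T_B)
    moreover have "\<dots> = (\<integral>x. indicator B x * birkhoff_max T f n x \<partial>M)"
      by (rule integral_T) measurable
    moreover have "\<dots> \<le> (\<integral>x. indicator B x * birkhoff_max T f (Suc n) x \<partial>M)"
      by (intro integral_mono int_B max_int mult_left_mono birkhoff_max_le_Suc) auto
    ultimately show ?thesis by linarith
  qed
  have "(\<lambda>n. \<integral>x. D n x \<partial>M) \<longlonglongrightarrow> (\<integral>x. indicator B x * f x \<partial>M)"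
  proof (rule integral_dominated_convergence[where w = "\<lambda>x. \<bar>f x\<bar>"])
    show "AE x in M. (\<lambda>n. D n x) \<longlonglongrightarrow> indicator B x * f x"
    proof (rule AE_I2)
      fix x assume x: "x \<in> space M"
      show "(\<lambda>n. D n x) \<longlonglongrightarrow> indicator B x * f x"
      proof (cases "x \<in> B")
        case True
        then have "T x \<in> B" using T_B[OF x] by simp
        \<comment> \<open>On \<open>B\<close> the sums along the orbit of \<open>T x\<close> exceed
          \<open>- f x\<close> at some index, and from there on the maximum in \<open>D_eq\<close>
          is \<open>f x\<close>: the convergence is by eventual equality.\<close>
        then obtain N where N: "- f x < birkhoff_sum T f N (T x)"
          unfolding B_def bdd_above_def by (auto simp: not_le)
        have "D n x = indicator B x * f x" if "n \<ge> N" for n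
          using N birkhoff_sum_le_max[of T f N "T x"] birkhoff_max_mono[OF that, of T f "T x"]
          unfolding D_eq by auto
        then show ?thesis
          by (intro tendsto_eventually) (auto simp: eventually_sequentially)
      qed (simp add: D_def)
    qed
    show "AE x in M. norm (D n x) \<le> \<bar>f x\<bar>" for n
    proof (rule AE_I2)
      fix x
      show "norm (D n x) \<le> \<bar>f x\<bar>"
        using birkhoff_max_nonneg[of T f n "T x"] unfolding D_eq by (auto simp: indicator_def)
    qed
    show "D n \<in> borel_measurable M" for n
      unfolding D_def[abs_def] by measurable
  qed (use f in auto)
  then have "0 \<le> (\<integral>x. indicator B x * f x \<partial>M)"
    by (rule LIMSEQ_le_const) (use D_nonneg in auto)
  then have "\<not> measure M B > 0"
    using neg[OF B_inv] by (auto simp: set_lebesgue_integral_def)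
  then have "emeasure M B = 0"
    by (simp add: emeasure_eq_measure zero_less_measure_iff)
  then have "AE x in M. x \<notin> B"
    by (intro AE_not_in) auto
  then show ?thesis
    using AE_space by eventually_elim (auto simp: B_def)
qed

text \<open>Each sublevel set of \<open>g\<close> at a rational level is invariant up to a null set,
  and countably many null sets can be discarded together. If \<open>g (T x)\<close> and
  \<open>g x\<close> differed, a rational between them would separate the two values.\<close>

lemma AE_invariant_T:
  fixes g :: "'a \<Rightarrow> real"
  assumes g: "g \<in> borel_measurable Inv"
  shows "AE x in M. g (T x) = g x"
proof -
  have sp: "space Inv = space M"
    using Inv.subalg by (simp add: subalgebra_def)
  have "AE x in M. g (T x) < q \<longleftrightarrow> g x < q" for q
  proof -
    have "{x \<in> space Inv. g x < q} \<in> sets Inv" using g by measurable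
    then have "AE x in M. T x \<in> {x \<in> space M. g x < q} \<longleftrightarrow> x \<in> {x \<in> space M. g x < q}"
      unfolding sp sets_invariant_algebra[OF T_measurable] invariant_sets_iff_AE[OF T_measurable] by auto
    then show ?thesis
      using AE_space by eventually_elim (use measurable_space[OF T_measurable] in auto)
  qed
  then have "AE x in M. \<forall>q\<in>\<rat>. g (T x) < q \<longleftrightarrow> g x < q"
    by (subst AE_ball_countable) (auto simp: countable_rat)
  then show ?thesis
  proof eventually_elim
    case (elim x)
    show ?case
    proof (rule ccontr)
      assume "g (T x) \<noteq> g x"
      then consider "g (T x) < g x" | "g x < g (T x)" by linarith
      then show False
        using elim Rats_dense_in_real[of "g (T x)" "g x"] Rats_dense_in_real[of "g x" "g (T x)"]
        by cases force+
    qed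
  qed
qed

lemma AE_invariant_funpow:
  fixes g :: "'a \<Rightarrow> real"
  assumes g: "g \<in> borel_measurable Inv"
  shows "AE x in M. \<forall>n. g ((T ^^ n) x) = g x"
proof -
  have "AE x in M. \<forall>n. g (T ((T ^^ n) x)) = g ((T ^^ n) x)"
    unfolding AE_all_countable using AE_funpow[OF AE_invariant_T[OF g]] by auto
  then show ?thesis
  proof eventually_elim
    case (elim x)
    show ?case
    proof
      fix n show "g ((T ^^ n) x) = g x" using elim by (induction n) auto
    qed
  qed
qed

text \<open>With \<open>g\<close> the conditional expectation, both \<open>f - g - e\<close> and
  \<open>g - f - e\<close> have integral \<open>- e * measure M B < 0\<close> over every invariant
  \<open>B\<close> of positive measure. Their Birkhoff sums are therefore bounded above almost
  everywhere, which keeps the averages of \<open>f\<close> asymptotically within \<open>e\<close> of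
  \<open>g\<close>.\<close>

theorem birkhoff:
  assumes f: "integrable M f"
  shows "AE x in M. (\<lambda>n. birkhoff_sum T f n x / n) \<longlonglongrightarrow> real_cond_exp M Inv f x"
proof -
  define g where "g = real_cond_exp M Inv f"
  have g: "integrable M g" unfolding g_def by (rule Inv.real_cond_exp_int(1)[OF f])
  have g_inv: "AE x in M. \<forall>n. g ((T ^^ n) x) = g x"
    by (rule AE_invariant_funpow) (simp add: g_def)
  \<comment> \<open>The sign \<open>s\<close> is later 1 for the upper and -1 for the lower
    estimate; \<open>e > 0\<close> makes the integrals strictly negative.\<close>
  have bdd: "AE x in M. bdd_above (range (\<lambda>n. birkhoff_sum T (\<lambda>x. s * (f x - g x) - e) n x))"
    if "e > 0" for s e :: real
  proof (rule AE_bdd_above_birkhoff_sum)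
    show "integrable M (\<lambda>x. s * (f x - g x) - e)" using f g by auto
    fix B assume B: "B \<in> sets Inv" "measure M B > 0"
    then have [measurable]: "B \<in> sets M"
      using Inv.subalg by (auto simp: subalgebra_def)
    have int_B: "integrable M (\<lambda>x. indicator B x * h x)" if "integrable M h" for h :: "'a \<Rightarrow> real"
      using integrable_mult_indicator[OF _ that] by simp
    have "(\<integral>x. indicator B x * f x \<partial>M) = (\<integral>x. indicator B x * g x \<partial>M)"
      using Inv.real_cond_exp_intA[OF f B(1)] by (simp add: set_lebesgue_integral_def g_def)
    moreover have "(LINT x:B|M. s * (f x - g x) - e) =
      (\<integral>x. s * (indicator B x * f x) - s * (indicator B x * g x) - e * indicator B x \<partial>M)"
      by (simp add: set_lebesgue_integral_def algebra_simps)
    moreover have "\<dots> = s * (\<integral>x. indicator B x * f x \<partial>M)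
        - s * (\<integral>x. indicator B x * g x \<partial>M) - e * measure M B"
      using int_B[OF f] int_B[OF g] by (simp add: emeasure_eq_measure)
    ultimately show "(LINT x:B|M. s * (f x - g x) - e) < 0"
      using B(2) that by simp
  qed
  \<comment> \<open>Taking \<open>e = 1 / Suc j\<close> leaves countably many exceptional null sets,
    so one set of good points serves all \<open>j\<close>.\<close>
  have "AE x in M. \<forall>j. bdd_above (range (\<lambda>n. birkhoff_sum T (\<lambda>x. s * (f x - g x) - 1 / Suc j) n x))" for s
    unfolding AE_all_countable using bdd by auto
  from this[of 1] this[of "-1"] g_inv show ?thesis
  proof eventually_elim
    case (elim x)
    \<comment> \<open>Since \<open>g\<close> is constant along the orbit of a good point, its
      Birkhoff sum is \<open>n * g x\<close>.\<close>
    have sum_eq: "birkhoff_sum T (\<lambda>x. s * (f x - g x) - e) n x = s * (birkhoff_sum T f n x - n * g x) - n * e"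
      for s e n
      using elim(3) by (simp add: birkhoff_sum_def sum_subtractf sum_distrib_left[symmetric] algebra_simps)
    show "(\<lambda>n. birkhoff_sum T f n x / n) \<longlonglongrightarrow> real_cond_exp M Inv f x"
      unfolding g_def[symmetric]
    proof (rule LIMSEQ_I)
      fix r :: real assume r: "r > 0"
      then obtain j where j: "1 / Suc j < r / 2"
        using reals_Archimedean[of "r/2"] by (auto simp: inverse_eq_divide)
      obtain K1 where K1: "\<And>n. 1 * (birkhoff_sum T f n x - n * g x) - n * (1 / Suc j) \<le> K1"
        using spec[OF elim(1), of j] unfolding sum_eq by (auto simp: bdd_above_def)
      obtain K2 where K2: "\<And>n. -1 * (birkhoff_sum T f n x - n * g x) - n * (1 / Suc j) \<le> K2"
        using spec[OF elim(2), of j] unfolding sum_eq by (auto simp: bdd_above_def)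
      define K where "K = max K1 K2"
      \<comment> \<open>Half of \<open>r\<close> absorbs \<open>1 / Suc j\<close>; the other half
        absorbs \<open>K / n\<close>, which is below it once \<open>n > 2 * K / r\<close>.\<close>
      obtain N :: nat where N: "2 * K / r < N" using reals_Archimedean2 by blast
      show "\<exists>no. \<forall>n\<ge>no. norm (birkhoff_sum T f n x / real n - g x) < r"
      proof (intro exI[of _ "Suc N"] allI impI)
        fix n assume n: "Suc N \<le> n"
        then have n0: "real n > 0" by simp
        have "2 * K / r < n" using N n by linarith
        then have K: "K < n * (r / 2)" using r by (simp add: field_simps)
        have "\<bar>birkhoff_sum T f n x - n * g x\<bar> \<le> K + n * (1 / Suc j)"
          using order_trans[OF K1[of n], of K] order_trans[OF K2[of n], of K]
          by (simp add: K_def abs_le_iff)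
        also have "\<dots> < n * (r / 2) + n * (r / 2)"
          using K mult_strict_left_mono[OF j n0] by linarith
        finally have "\<bar>birkhoff_sum T f n x - n * g x\<bar> < n * r" by (simp add: mult.commute)
        moreover have "birkhoff_sum T f n x / real n - g x = (birkhoff_sum T f n x - n * g x) / n"
          using n0 by (simp add: field_simps)
        ultimately show "norm (birkhoff_sum T f n x / real n - g x) < r"
          using n0 by (simp add: field_simps abs_divide)
      qed
    qed
  qed
qed

text \<open>Summing from 1 instead of 0 gives the Birkhoff sum at \<open>T x\<close>, and the limit
  there is the same because the conditional expectation is invariant.\<close>

lemma AE_average_tendsto:
  assumes f: "integrable M f"
  shows "AE x in M. (\<lambda>N. (\<Sum>n=1..N. f ((T ^^ n) x)) / N) \<longlonglongrightarrow> real_cond_exp M Inv f x"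
proof -
  have sum_eq: "(\<Sum>n=1..N. f ((T ^^ n) x)) = birkhoff_sum T f N (T x)" for N x
    by (simp add: birkhoff_sum_def sum.atLeast1_atMost_eq funpow_swap1)
  have "AE x in M. (\<lambda>n. birkhoff_sum T f n (T x) / n) \<longlonglongrightarrow> real_cond_exp M Inv f (T x)"
    using AE_funpow[OF birkhoff[OF f], of 1] by simp
  moreover have "AE x in M. real_cond_exp M Inv f (T x) = real_cond_exp M Inv f x"
    by (rule AE_invariant_T) simp
  ultimately show ?thesis
    unfolding sum_eq by eventually_elim simp
qed

end

section \<open>Convergence of the double averages\<close>

lemma abs_average_le:
  fixes f :: "nat \<Rightarrow> real"
  assumes "\<And>n. \<bar>f n\<bar> \<le> c" "0 \<le> c"
  shows "\<bar>(\<Sum>n=1..N. f n) / N\<bar> \<le> c"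
proof (cases "N = 0")
  case False
  have "\<bar>\<Sum>n=1..N. f n\<bar> \<le> (\<Sum>n=1..N. c)"
    by (rule order_trans[OF sum_abs sum_mono]) (use assms in auto)
  then show ?thesis using False by (simp add: abs_divide field_simps)
\<comment> \<open>For \<open>N = 0\<close> the quotient is 0 by the convention on division by zero,
  hence \<open>0 \<le> c\<close>.\<close>
qed (use assms in simp)

lemma double_average_tendsto:
  fixes f0 f1 f2 :: "'a \<Rightarrow> real"
  assumes "measure_preserving_system M T1" "measure_preserving_system M T2"
    and meas [measurable]: "f0 \<in> borel_measurable M" "f1 \<in> borel_measurable M" "f2 \<in> borel_measurable M"
    and bound: "\<And>x. \<bar>f0 x\<bar> \<le> 1" "\<And>x. \<bar>f1 x\<bar> \<le> 1" "\<And>x. \<bar>f2 x\<bar> \<le> 1"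
  shows "(\<lambda>N. 1 / (real N)\<^sup>2 * (\<Sum>n=1..N. \<Sum>m=1..N.
             \<integral>x. f0 x * f1 ((T1 ^^ n) x) * f2 ((T2 ^^ (n + m)) x) \<partial>M))
         \<longlonglongrightarrow> (\<integral>x. f0 x * real_cond_exp M (invariant_algebra M T1) f1 x *
                       real_cond_exp M (invariant_algebra M T2) f2 x \<partial>M)"
proof -
  interpret P1: measure_preserving_system M T1 by fact
  interpret P2: measure_preserving_system M T2 by fact
  define g where "g = real_cond_exp M (invariant_algebra M T1) f1"
  define h where "h = real_cond_exp M (invariant_algebra M T2) f2"
  define V where "V N x = (\<Sum>n=1..N. f1 ((T1 ^^ n) x)) / real N" for N x
  define U where "U N x = (\<Sum>m=1..N. f2 ((T2 ^^ m) x)) / real N" for N x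
  have [measurable]: "g \<in> borel_measurable M" "h \<in> borel_measurable M"
    by (simp_all add: g_def h_def)
  have it1: "(\<lambda>x. k ((T1 ^^ n) x)) \<in> borel_measurable M"
    if "k \<in> borel_measurable M" for k :: "'a \<Rightarrow> real" and n
    using measurable_compose[OF P1.funpow_measurable that] .
  have it2: "(\<lambda>x. k ((T2 ^^ n) x)) \<in> borel_measurable M"
    if "k \<in> borel_measurable M" for k :: "'a \<Rightarrow> real" and n
    using measurable_compose[OF P2.funpow_measurable that] .
  have [measurable]: "V N \<in> borel_measurable M" "U N \<in> borel_measurable M" for N
    unfolding V_def[abs_def] U_def[abs_def]
    by (intro borel_measurable_divide borel_measurable_sum it1[OF meas(2)] it2[OF meas(3)] borel_measurable_const)+
  have [measurable]: "(\<lambda>x. U N ((T2 ^^ n) x)) \<in> borel_measurable M"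
    "(\<lambda>x. h ((T2 ^^ n) x)) \<in> borel_measurable M" for N n
    by (rule it2, simp)+
  have f2_int: "integrable M f2" and f1_int: "integrable M f1"
    using bound by (auto intro!: P1.integrable_const_bound[where B = 1])
  have h_bound: "AE x in M. \<bar>h x\<bar> \<le> 1"
  proof -
    have "AE x in M. -1 \<le> h x" unfolding h_def
      by (rule P2.Inv.real_cond_exp_ge_c[OF f2_int]) (use bound(3) in \<open>auto simp: abs_le_iff minus_le_iff\<close>)
    moreover have "AE x in M. h x \<le> 1" unfolding h_def
      by (rule P2.Inv.real_cond_exp_le_c[OF f2_int]) (use bound(3) in \<open>auto simp: abs_le_iff\<close>)
    ultimately show ?thesis by eventually_elim auto
  qed
  have U_bound: "\<bar>U N x\<bar> \<le> 1" and V_bound: "\<bar>V N x\<bar> \<le> 1" for N x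
    unfolding U_def V_def by (rule abs_average_le; use bound in simp)+
  have prod_bound: "\<bar>a * b * c\<bar> \<le> 1" if "\<bar>a\<bar> \<le> 1" "\<bar>b\<bar> \<le> 1" "\<bar>c\<bar> \<le> 1" for a b c :: real
    using mult_mono[OF mult_mono[OF that(1,2)] that(3)] by (simp add: abs_mult)
  \<comment> \<open>The third factor is bounded only almost everywhere, so that it can be the
    conditional expectation \<open>h\<close>.\<close>
  have prod_int: "integrable M (\<lambda>x. a x * b x * c x)"
    if "a \<in> borel_measurable M" "b \<in> borel_measurable M" "c \<in> borel_measurable M"
      "\<And>x. \<bar>a x\<bar> \<le> 1" "\<And>x. \<bar>b x\<bar> \<le> 1" "AE x in M. \<bar>c x\<bar> \<le> 1" for a b c :: "'a \<Rightarrow> real"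
  proof (rule P1.integrable_const_bound[where B = 1])
    show "AE x in M. norm (a x * b x * c x) \<le> 1"
      using that(6) by eventually_elim (use prod_bound that in simp)
  qed (use that in measurable)
  define a where "a N = 1 / (real N)\<^sup>2 * (\<Sum>n=1..N. \<Sum>m=1..N.
      \<integral>x. f0 x * f1 ((T1 ^^ n) x) * f2 ((T2 ^^ (n + m)) x) \<partial>M)" for N
  define b where "b N = (\<integral>x. f0 x * V N x * h x \<partial>M)" for N
  define \<delta> where "\<delta> N = (\<integral>x. \<bar>U N x - h x\<bar> \<partial>M)" for N
  have int_n: "integrable M (\<lambda>x. f0 x * f1 ((T1 ^^ n) x) * c x)"
    if "c \<in> borel_measurable M" "AE x in M. \<bar>c x\<bar> \<le> 1" for c :: "'a \<Rightarrow> real" and n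
    by (rule prod_int) (use that bound in \<open>auto intro: it1[OF meas(2)]\<close>)
  \<comment> \<open>As \<open>T2 ^^ (n + m)\<close> applies \<open>T2 ^^ n\<close> first and then
    \<open>T2 ^^ m\<close>, the average over \<open>m\<close> is \<open>U N\<close> evaluated at
    \<open>(T2 ^^ n) x\<close>; only powers of the same map are interchanged.\<close>
  have a_eq: "a N = (\<Sum>n=1..N. \<integral>x. f0 x * f1 ((T1 ^^ n) x) * U N ((T2 ^^ n) x) \<partial>M) / N" for N
  proof -
    have "(\<integral>x. f0 x * f1 ((T1 ^^ n) x) * U N ((T2 ^^ n) x) \<partial>M) =
        (\<Sum>m=1..N. \<integral>x. f0 x * f1 ((T1 ^^ n) x) * f2 ((T2 ^^ (n + m)) x) \<partial>M) / N" for n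
    proof -
      have "(\<integral>x. f0 x * f1 ((T1 ^^ n) x) * U N ((T2 ^^ n) x) \<partial>M) =
        (\<integral>x. (\<Sum>m=1..N. f0 x * f1 ((T1 ^^ n) x) * f2 ((T2 ^^ (n + m)) x)) / N \<partial>M)"
        by (simp add: U_def sum_distrib_left funpow_add add.commute[of n])
      also have "\<dots> = (\<integral>x. (\<Sum>m=1..N. f0 x * f1 ((T1 ^^ n) x) * f2 ((T2 ^^ (n + m)) x)) \<partial>M) / N"
        by simp
      also have "(\<integral>x. (\<Sum>m=1..N. f0 x * f1 ((T1 ^^ n) x) * f2 ((T2 ^^ (n + m)) x)) \<partial>M) =
        (\<Sum>m=1..N. \<integral>x. f0 x * f1 ((T1 ^^ n) x) * f2 ((T2 ^^ (n + m)) x) \<partial>M)"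
        by (intro Bochner_Integration.integral_sum int_n it2[OF meas(3)] AE_I2 bound)
      finally show ?thesis .
    qed
    then show ?thesis
      by (simp add: a_def power2_eq_square sum_divide_distrib[symmetric])
  qed
  have b_eq: "b N = (\<Sum>n=1..N. \<integral>x. f0 x * f1 ((T1 ^^ n) x) * h x \<partial>M) / N" for N
  proof -
    have "b N = (\<integral>x. (\<Sum>n=1..N. f0 x * f1 ((T1 ^^ n) x) * h x) / N \<partial>M)"
      by (simp add: b_def V_def sum_distrib_left sum_distrib_right)
    also have "\<dots> = (\<integral>x. (\<Sum>n=1..N. f0 x * f1 ((T1 ^^ n) x) * h x) \<partial>M) / N"
      by simp
    also have "(\<integral>x. (\<Sum>n=1..N. f0 x * f1 ((T1 ^^ n) x) * h x) \<partial>M) =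
        (\<Sum>n=1..N. \<integral>x. f0 x * f1 ((T1 ^^ n) x) * h x \<partial>M)"
      by (intro Bochner_Integration.integral_sum int_n h_bound) simp
    finally show ?thesis .
  qed
  have U_h_int: "integrable M (\<lambda>x. \<bar>U N ((T2 ^^ n) x) - h x\<bar>)" for N n
  proof (rule P1.integrable_const_bound[where B = 2])
    show "AE x in M. norm \<bar>U N ((T2 ^^ n) x) - h x\<bar> \<le> 2"
      using h_bound
    proof eventually_elim
      case (elim x)
      then show ?case using U_bound[of N "(T2 ^^ n) x"] by simp
    qed
  qed measurable
  have h_inv: "AE x in M. \<forall>n. h ((T2 ^^ n) x) = h x"
    by (rule P2.AE_invariant_funpow) (simp add: h_def)
  have term_bound: "\<bar>(\<integral>x. f0 x * f1 ((T1 ^^ n) x) * U N ((T2 ^^ n) x) \<partial>M)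
      - (\<integral>x. f0 x * f1 ((T1 ^^ n) x) * h x \<partial>M)\<bar> \<le> \<delta> N" for n N
  proof -
    have "(\<integral>x. f0 x * f1 ((T1 ^^ n) x) * U N ((T2 ^^ n) x) \<partial>M)
      - (\<integral>x. f0 x * f1 ((T1 ^^ n) x) * h x \<partial>M) =
      (\<integral>x. f0 x * f1 ((T1 ^^ n) x) * U N ((T2 ^^ n) x) - f0 x * f1 ((T1 ^^ n) x) * h x \<partial>M)"
      by (intro Bochner_Integration.integral_diff[symmetric] int_n h_bound AE_I2 U_bound) auto
    also have "\<bar>\<dots>\<bar> \<le> (\<integral>x. \<bar>f0 x * f1 ((T1 ^^ n) x) * U N ((T2 ^^ n) x) - f0 x * f1 ((T1 ^^ n) x) * h x\<bar> \<partial>M)"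
      by (rule integral_abs_bound)
    also have "\<dots> \<le> (\<integral>x. \<bar>U N ((T2 ^^ n) x) - h x\<bar> \<partial>M)"
    proof (rule integral_mono)
      show "integrable M (\<lambda>x. \<bar>f0 x * f1 ((T1 ^^ n) x) * U N ((T2 ^^ n) x) - f0 x * f1 ((T1 ^^ n) x) * h x\<bar>)"
        by (intro integrable_abs Bochner_Integration.integrable_diff int_n h_bound AE_I2 U_bound) auto
      show "\<bar>f0 x * f1 ((T1 ^^ n) x) * U N ((T2 ^^ n) x) - f0 x * f1 ((T1 ^^ n) x) * h x\<bar>
          \<le> \<bar>U N ((T2 ^^ n) x) - h x\<bar>" for x
      proof -
        have "\<bar>f0 x * f1 ((T1 ^^ n) x)\<bar> \<le> 1"
          using prod_bound[of "f0 x" "f1 ((T1 ^^ n) x)" 1] bound by simp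
        then show ?thesis
          using mult_right_mono[of "\<bar>f0 x * f1 ((T1 ^^ n) x)\<bar>" 1 "\<bar>U N ((T2 ^^ n) x) - h x\<bar>"]
          by (simp only: right_diff_distrib[symmetric] abs_mult) simp
      qed
    qed (rule U_h_int)
    \<comment> \<open>Invariance of \<open>h\<close> lets it be evaluated at
      \<open>(T2 ^^ n) x\<close> too; measure preservation then removes \<open>T2 ^^ n\<close>,
      making the bound uniform in \<open>n\<close>.\<close>
    also have "\<dots> = (\<integral>x. \<bar>U N ((T2 ^^ n) x) - h ((T2 ^^ n) x)\<bar> \<partial>M)"
    proof (rule Bochner_Integration.integral_cong_AE)
      show "AE x in M. \<bar>U N ((T2 ^^ n) x) - h x\<bar> = \<bar>U N ((T2 ^^ n) x) - h ((T2 ^^ n) x)\<bar>"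
        using h_inv by eventually_elim simp
    qed measurable
    also have "\<dots> = \<delta> N"
      unfolding \<delta>_def by (rule P2.integral_funpow[where f = "\<lambda>x. \<bar>U N x - h x\<bar>"]) measurable
    finally show ?thesis .
  qed
  have \<delta>_nonneg: "0 \<le> \<delta> N" for N
    unfolding \<delta>_def by simp
  have diff_bound: "norm (a N - b N) \<le> \<delta> N" for N
    using abs_average_le[of "\<lambda>n. (\<integral>x. f0 x * f1 ((T1 ^^ n) x) * U N ((T2 ^^ n) x) \<partial>M)
      - (\<integral>x. f0 x * f1 ((T1 ^^ n) x) * h x \<partial>M)", OF term_bound \<delta>_nonneg, of N]
    by (simp add: a_eq b_eq sum_subtractf diff_divide_distrib)
  have \<delta>_tendsto: "\<delta> \<longlonglongrightarrow> (\<integral>x. 0 \<partial>M)"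
    unfolding \<delta>_def[abs_def]
  proof (rule integral_dominated_convergence[where w = "\<lambda>_. 2"])
    show "AE x in M. (\<lambda>N. \<bar>U N x - h x\<bar>) \<longlonglongrightarrow> 0"
      using P2.AE_average_tendsto[OF f2_int]
    proof eventually_elim
      case (elim x)
      then have "(\<lambda>N. U N x - h x) \<longlonglongrightarrow> 0"
        unfolding U_def h_def by (simp add: LIM_zero)
      then show ?case by (rule tendsto_rabs_zero)
    qed
    show "AE x in M. norm \<bar>U N x - h x\<bar> \<le> 2" for N
      using h_bound
    proof eventually_elim
      case (elim x)
      then show ?case using U_bound[of N x] by simp
    qed
  qed auto
  have b_tendsto: "b \<longlonglongrightarrow> (\<integral>x. f0 x * g x * h x \<partial>M)"
    unfolding b_def[abs_def]
  proof (rule integral_dominated_convergence[where w = "\<lambda>_. 1"])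
    show "AE x in M. (\<lambda>N. f0 x * V N x * h x) \<longlonglongrightarrow> f0 x * g x * h x"
      using P1.AE_average_tendsto[OF f1_int]
    proof eventually_elim
      case (elim x)
      then show ?case unfolding V_def g_def by (intro tendsto_intros)
    qed
    show "AE x in M. norm (f0 x * V N x * h x) \<le> 1" for N
      using h_bound by eventually_elim (use prod_bound bound V_bound in simp)
  qed auto
  have "(\<lambda>N. a N - b N) \<longlonglongrightarrow> 0"
    by (rule Lim_null_comparison[OF _ \<delta>_tendsto[simplified]]) (use diff_bound in simp)
  from tendsto_add[OF this b_tendsto] show ?thesis
    by (simp add: a_def[abs_def] g_def h_def)
qed

section \<open>The lower bound for nested sub-sigma-algebras\<close>

text \<open>Because \<open>g * h\<close> is measurable for the larger algebra \<open>G\<close>, the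
  factor \<open>f\<close> may be replaced by \<open>h\<close>. Two pointwise inequalities then
  compare the integral of \<open>g * h * h\<close> with that of the cube of \<open>g\<close>, and
  the latter with the cube of the mean.\<close>

lemma (in prob_space) cube_integral_le_nested_cond_exp:
  assumes f [measurable]: "f \<in> borel_measurable M" and bound: "\<And>x. 0 \<le> f x" "\<And>x. f x \<le> 1"
    and F: "subalgebra M F" and G: "subalgebra M G" and FG: "sets F \<subseteq> sets G"
  shows "(\<integral>x. f x \<partial>M) ^ 3 \<le> (\<integral>x. f x * real_cond_exp M F f x * real_cond_exp M G f x \<partial>M)"
proof -
  interpret F: finite_measure_subalgebra M F by unfold_locales (rule F)
  interpret G: finite_measure_subalgebra M G by unfold_locales (rule G)
  have GF: "subalgebra G F" using F G FG by (auto simp: subalgebra_def)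
  define g where "g = real_cond_exp M F f"
  define h where "h = real_cond_exp M G f"
  define c where "c = (\<integral>x. f x \<partial>M)"
  have f_int: "integrable M f"
    using bound by (auto intro!: integrable_const_bound[where B = 1])
  have g_F [measurable]: "g \<in> borel_measurable F" by (simp add: g_def)
  have h_G [measurable]: "h \<in> borel_measurable G" by (simp add: h_def)
  \<comment> \<open>The inclusion of the algebras enters here: it allows \<open>g\<close> in weights
    for conditioning on \<open>G\<close>.\<close>
  have g_G [measurable]: "g \<in> borel_measurable G"
    by (rule measurable_from_subalg[OF GF g_F])
  have [measurable]: "g \<in> borel_measurable M" "h \<in> borel_measurable M"
    by (simp_all add: g_def h_def)
  have "AE x in M. 0 \<le> g x" "AE x in M. g x \<le> 1" "AE x in M. 0 \<le> h x" "AE x in M. h x \<le> 1"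
    unfolding g_def h_def using bound
    by (auto intro!: F.real_cond_exp_ge_c F.real_cond_exp_le_c G.real_cond_exp_ge_c G.real_cond_exp_le_c f_int)
  then have gh: "AE x in M. 0 \<le> g x \<and> g x \<le> 1 \<and> 0 \<le> h x \<and> h x \<le> 1"
    by eventually_elim auto
  have int: "integrable M (\<lambda>x. a x * b x * k x)"
    if "a \<in> borel_measurable M" "b \<in> borel_measurable M" "k \<in> borel_measurable M"
      "AE x in M. 0 \<le> a x \<and> a x \<le> 1" "AE x in M. 0 \<le> b x \<and> b x \<le> 1" "AE x in M. 0 \<le> k x \<and> k x \<le> 1"
    for a b k :: "'a \<Rightarrow> real"
  proof (rule integrable_const_bound[where B = 1])
    show "AE x in M. norm (a x * b x * k x) \<le> 1"
      using that(4-6) by eventually_elim (auto simp: abs_mult intro!: mult_le_one)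
  qed (use that in measurable)
  have g1: "AE x in M. 0 \<le> g x \<and> g x \<le> 1" and h1: "AE x in M. 0 \<le> h x \<and> h x \<le> 1"
    and f1: "AE x in M. 0 \<le> f x \<and> f x \<le> 1"
    using gh bound by auto
  have ghh: "(\<integral>x. g x * h x * h x \<partial>M) = (\<integral>x. g x * h x * f x \<partial>M)"
    using G.real_cond_exp_intg(2)[of "\<lambda>x. g x * h x" f] int[of g h f] g1 h1 f1 by (simp add: h_def[symmetric])
  have ggh: "(\<integral>x. g x * g x * h x \<partial>M) = (\<integral>x. g x * g x * f x \<partial>M)"
    using G.real_cond_exp_intg(2)[of "\<lambda>x. g x * g x" f] int[of g g f] g1 f1 by (simp add: h_def[symmetric])
  have ggg: "(\<integral>x. g x * g x * g x \<partial>M) = (\<integral>x. g x * g x * f x \<partial>M)"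
    using F.real_cond_exp_intg(2)[of "\<lambda>x. g x * g x" f] int[of g g f] g1 f1 by (simp add: g_def[symmetric])
  have g_int: "integrable M g" and g_c: "(\<integral>x. g x \<partial>M) = c"
    unfolding g_def c_def using F.real_cond_exp_int[OF f_int] by auto
  have c0: "0 \<le> c" unfolding c_def using bound by simp
  note ints = int[of g g g] int[of g g h] int[of g h h]
  \<comment> \<open>\<open>g (h - g)\<^sup>2 \<ge> 0\<close>\<close>
  have "(\<integral>x. 2 * (g x * g x * h x) - g x * g x * g x \<partial>M) \<le> (\<integral>x. g x * h x * h x \<partial>M)"
  proof (rule integral_mono_AE)
    show "AE x in M. 2 * (g x * g x * h x) - g x * g x * g x \<le> g x * h x * h x"
      using gh
    proof eventually_elim
      case (elim x)
      then have "0 \<le> g x * (h x - g x)\<^sup>2" by simp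
      then show ?case by (simp add: power2_eq_square algebra_simps)
    qed
  qed (use ints g1 h1 in auto)
  \<comment> \<open>The weight \<open>g * g\<close> is measurable for both algebras, so against it
    \<open>f\<close>, \<open>g\<close> and \<open>h\<close> all have the same integral.\<close>
  also have "(\<integral>x. 2 * (g x * g x * h x) - g x * g x * g x \<partial>M) = (\<integral>x. g x * g x * g x \<partial>M)"
    using ints g1 h1 by (simp add: ggh ggg)
  finally have 1: "(\<integral>x. g x * g x * g x \<partial>M) \<le> (\<integral>x. g x * h x * h x \<partial>M)" .
  \<comment> \<open>tangent line of the cube at \<open>c\<close>\<close>
  have "(\<integral>x. 3 * c\<^sup>2 * g x - 2 * c ^ 3 \<partial>M) \<le> (\<integral>x. g x * g x * g x \<partial>M)"
  proof (rule integral_mono_AE)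
    show "AE x in M. 3 * c\<^sup>2 * g x - 2 * c ^ 3 \<le> g x * g x * g x"
      using gh
    proof eventually_elim
      case (elim x)
      \<comment> \<open>The cube minus its tangent at \<open>c\<close> factors with a double root at
        \<open>c\<close> and a simple root at \<open>- 2 * c\<close>.\<close>
      then have "0 \<le> (g x + 2 * c) * (g x - c)\<^sup>2" using c0 by simp
      then show ?case by (simp add: power2_eq_square power3_eq_cube algebra_simps)
    qed
  qed (use ints g1 g_int in auto)
  also have "(\<integral>x. 3 * c\<^sup>2 * g x - 2 * c ^ 3 \<partial>M) = 3 * c\<^sup>2 * c - 2 * c ^ 3"
    using g_int by (simp add: g_c prob_space)
  also have "\<dots> = c ^ 3"
    by (simp add: power2_eq_square power3_eq_cube)
  finally have "c ^ 3 \<le> (\<integral>x. g x * h x * h x \<partial>M)" using 1 by linarith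
  then show ?thesis
    unfolding ghh by (simp add: c_def g_def h_def mult_ac)
qed

section \<open>Specialisation to indicator functions\<close>

theorem corollary1:
  fixes M :: "'a measure" and T1 T2 :: "'a \<Rightarrow> 'a" and A :: "'a set"
  assumes "prob_space M"
    and "measure_preserving M T1"
    and "measure_preserving M T2"
    and "A \<in> sets M"
    and "measure M A > 0"
  shows "(\<lambda>N. 1 / (real N)\<^sup>2 * (\<Sum>n=1..N. \<Sum>m=1..N.
             measure M (A \<inter> preimage_iter M T1 n A \<inter> preimage_iter M T2 (n + m) A)))
           \<longlonglongrightarrow> (LINT x:A|M. real_cond_exp M (invariant_algebra M T1) (indicator A) x *
                            real_cond_exp M (invariant_algebra M T2) (indicator A) x)
       \<and> (sets (invariant_algebra M T1) \<subseteq> sets (invariant_algebra M T2) \<or>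
          sets (invariant_algebra M T2) \<subseteq> sets (invariant_algebra M T1) \<longrightarrow>
            lim (\<lambda>N. 1 / (real N)\<^sup>2 * (\<Sum>n=1..N. \<Sum>m=1..N.
             measure M (A \<inter> preimage_iter M T1 n A \<inter> preimage_iter M T2 (n + m) A)))
            \<ge> measure M A ^ 3)"
proof -
  interpret P1: measure_preserving_system M T1
    using assms by (simp add: measure_preserving_system_def measure_preserving_system_axioms_def)
  interpret P2: measure_preserving_system M T2
    using assms by (simp add: measure_preserving_system_def measure_preserving_system_axioms_def)
  have [measurable]: "A \<in> sets M" by fact
  define g where "g = real_cond_exp M (invariant_algebra M T1) (indicator A)"
  define h where "h = real_cond_exp M (invariant_algebra M T2) (indicator A)"
  define a where "a N = 1 / (real N)\<^sup>2 * (\<Sum>n=1..N. \<Sum>m=1..N.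
             measure M (A \<inter> preimage_iter M T1 n A \<inter> preimage_iter M T2 (n + m) A))" for N
  have measure_eq: "measure M (A \<inter> preimage_iter M T1 n A \<inter> preimage_iter M T2 k A) =
      (\<integral>x. indicator A x * indicator A ((T1 ^^ n) x) * indicator A ((T2 ^^ k) x) \<partial>M)" for n k
  proof -
    have "A \<inter> preimage_iter M T1 n A \<inter> preimage_iter M T2 k A \<in> sets M"
      unfolding preimage_iter_def
      by (intro sets.Int measurable_sets[OF P1.funpow_measurable] measurable_sets[OF P2.funpow_measurable]) auto
    then have "measure M (A \<inter> preimage_iter M T1 n A \<inter> preimage_iter M T2 k A) =
      (\<integral>x. indicator (A \<inter> preimage_iter M T1 n A \<inter> preimage_iter M T2 k A) x \<partial>M)"
      by (simp add: sets.Int_space_eq2)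
    also have "\<dots> = (\<integral>x. indicator A x * indicator A ((T1 ^^ n) x) * indicator A ((T2 ^^ k) x) \<partial>M)"
      by (intro Bochner_Integration.integral_cong) (auto simp: indicator_def preimage_iter_def)
    finally show ?thesis .
  qed
  have "a \<longlonglongrightarrow> (\<integral>x. indicator A x * g x * h x \<partial>M)"
    unfolding a_def[abs_def] g_def h_def measure_eq
    by (rule double_average_tendsto)
      (auto simp: indicator_def intro: P1.measure_preserving_system_axioms P2.measure_preserving_system_axioms)
  then have lim: "a \<longlonglongrightarrow> (LINT x:A|M. g x * h x)"
    by (simp add: set_lebesgue_integral_def mult.assoc)
  \<comment> \<open>The value of \<open>lim a\<close> is known only through the convergence just
    proved, by \<open>limI\<close>.\<close>
  have "measure M A ^ 3 \<le> lim a"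
    if "sets (invariant_algebra M T1) \<subseteq> sets (invariant_algebra M T2) \<or>
        sets (invariant_algebra M T2) \<subseteq> sets (invariant_algebra M T1)"
    using that
  proof
    assume "sets (invariant_algebra M T1) \<subseteq> sets (invariant_algebra M T2)"
    from P1.cube_integral_le_nested_cond_exp[OF _ _ _ P1.Inv.subalg P2.Inv.subalg this, of "indicator A"]
    show ?thesis
      by (simp add: limI[OF lim] set_lebesgue_integral_def g_def h_def mult.assoc)
  next
    \<comment> \<open>The integral is symmetric in \<open>g\<close> and \<open>h\<close>, so the
      same inequality applies with the two algebras exchanged.\<close>
    assume "sets (invariant_algebra M T2) \<subseteq> sets (invariant_algebra M T1)"
    from P1.cube_integral_le_nested_cond_exp[OF _ _ _ P2.Inv.subalg P1.Inv.subalg this, of "indicator A"]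
    show ?thesis
      by (simp add: limI[OF lim] set_lebesgue_integral_def g_def h_def mult_ac)
  qed
  with lim show ?thesis
    unfolding a_def[abs_def] g_def h_def by blast
qed

end
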